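(* Let $\mathcal A$ be a real symmetric tensor of order $m$ and dimension $n$, and let $\{x_k\}$ be generated by the Equation-Based Newton Algorithm (described in the context). If there is an accumulation point $\bar x$ of $\{x_k\}$ at which the second order sufficient condition holds, i.e. $U_{\bar x}^TF'(\bar x)U_{\bar x}$ is positive definite, then $\bar x$ is a $Z$-eigenvector of $\mathcal A$ with $\mathcal A\bar x^m$ being the corresponding $Z$-eigenvalue. If, further, the whole sequence $\{x_k\}$ converges to $\bar x$, then the convergence rate of $\{x_k\}$ is quadratic, i.e. $\|x_{k+1}-\bar x\|=O(\|x_k-\bar x\|^2)$. Moreover, $\alpha_k=1$ is accepted for all $k$ sufficiently large.
   Context: Let $m\ge 2$ and $n$ be positive integers, and let $\mathcal A=(a_{i_1\ldots i_m})$, $1\le i_1,\ldots,i_m\le n$, be a real symmetric tensor (entries invariant under permutation of indices). For $x\in\mathbb R^n$, $\mathcal A x^{m-1}\in\mathbb R^n$ has $i$-th entry $\sum_{i_2,\ldots,i_m}a_{ii_2\ldots i_m}x_{i_2}\cdots x_{i_m}$; $\mathcal A x^m=x^T(\mathcal A x^{m-1})\in\mathbb R$; and $\mathcal A x^{m-2}\in\mathbb R^{n\times n}$ has $(i,j)$ entry $\sum_{i_3,\ldots,i_m}a_{iji_3\ldots i_m}x_{i_3}\cdots x_{i_m}$. $\|\cdot\|$ is the Euclidean norm and $\mathbb B=\{x\in\mathbb R^n: x^Tx=1\}$. A vector $x$ is a $Z$-eigenvector of $\mathcal A$ with $Z$-eigenvalue $\lambda\in\mathbb R$ if $\mathcal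 A x^{m-1}=\lambda x$ and $x^Tx=1$. Let $F(x)=\mathcal A x^{m-1}-(\mathcal A x^m)\,x$, whose Jacobian is $F'(x)=(m-1)\mathcal A x^{m-2}-(\mathcal A x^m) I-m\,x(\mathcal A x^{m-1})^T$, and let $\theta(x)=\frac12\|F(x)\|^2$. For $x\in\mathbb B$, $U_x\in\mathbb R^{n\times(n-1)}$ is a matrix whose columns form an orthogonal basis of $x^\perp=\{d\in\mathbb R^n: x^Td=0\}$. The second order sufficient condition is said to hold at $x\in\mathbb B$ if $U_x^TF'(x)U_x$ is positive definite. Equation-Based Newton Algorithm. Fix constants $\sigma\in(0,1)$, $\mu>0$, $\rho\in(0,1)$ and $x_0\in\mathbb B$. For $k=0,1,\ldots$, while $F(x_k)\neq0$: (1) solve the linear system $U_{x_k}^TF'(x_k)d_k+U_{x_k}^TF(x_k)=0$, $x_k^Td_k=0$ to get $d_k$; if this system is not solvable, let instead $d_k=-\nabla\theta(x_k)$ or let $d_k$ be the solution of $\big([F'(x_k)]^2+\mu\|F(x_k)\|I\big)d_k+F'(x_k)F(x_k)=0$; (2) with $x_k(\alpha)=\frac{x_k+\alpha d_k}{\|x_k+\alpha d_k\|}$, find by backtracking the largest $\alpha_k\in\{1,\rho,\rho^2,\ldots\}$ satisfying $\theta(x_k(\alpha_k))\le\theta(x_k)+\sigma\alpha_k[\nabla\theta(x_k)]^Td_k$; (3) let $x_{k+1}=x_k(\alpha_k)$. The statement concerns the case in which the algorithm generates an infinite sequence.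
   Formalization: Adds that eventually ∇θ(x_k)ᵀd_k ≤ 0 (the third choice of d_k can be an ascent direction, and the claim then fails), and assumes σ < 1/2 for the quadratic rate and for α_k = 1 (for σ ≥ 1/2 a unit Newton step is never accepted). *)

theory Defs
  imports "HOL-Analysis.Analysis" "HOL-Library.Multiset" "HOL-Library.Landau_Symbols"
begin

text \<open>
  A tensor of order \<open>m\<close> and dimension \<open>CARD('n)\<close> is given by its entries, indexed by the lists over
  \<open>'n\<close> of length \<open>m\<close>; the values at lists of any other length are never used.
\<close>

type_synonym 'n tensor = "'n list \<Rightarrow> real"

definition symmetric_tensor :: "nat \<Rightarrow> 'n tensor \<Rightarrow> bool" where
  "symmetric_tensor m A \<longleftrightarrow> (\<forall>p q. length p = m \<and> mset p = mset q \<longrightarrow> A p = A q)"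

definition tensor_vec :: "nat \<Rightarrow> 'n::finite tensor \<Rightarrow> real^'n \<Rightarrow> real^'n" where
  "tensor_vec m A x =
     (\<chi> i. \<Sum>p | length p = m - 1. A (i # p) * (\<Prod>k\<leftarrow>p. x $ k))"

definition tensor_form :: "nat \<Rightarrow> 'n::finite tensor \<Rightarrow> real^'n \<Rightarrow> real" where
  "tensor_form m A x = x \<bullet> tensor_vec m A x"

definition tensor_mat :: "nat \<Rightarrow> 'n::finite tensor \<Rightarrow> real^'n \<Rightarrow> real^'n^'n" where
  "tensor_mat m A x =
     (\<chi> i j. \<Sum>p | length p = m - 2. A (i # j # p) * (\<Prod>k\<leftarrow>p. x $ k))"

definition z_eigenpair :: "nat \<Rightarrow> 'n::finite tensor \<Rightarrow> real \<Rightarrow> real^'n \<Rightarrow> bool" where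
  "z_eigenpair m A l x \<longleftrightarrow> tensor_vec m A x = l *\<^sub>R x \<and> x \<bullet> x = 1"

definition eqF :: "nat \<Rightarrow> 'n::finite tensor \<Rightarrow> real^'n \<Rightarrow> real^'n" where
  "eqF m A x = tensor_vec m A x - tensor_form m A x *\<^sub>R x"

text \<open>The Jacobian of \<open>eqF m A\<close> for symmetric \<open>A\<close>. It is in general not a symmetric matrix.\<close>

definition jacF :: "nat \<Rightarrow> 'n::finite tensor \<Rightarrow> real^'n \<Rightarrow> real^'n^'n" where
  "jacF m A x =
     (real m - 1) *\<^sub>R tensor_mat m A x - tensor_form m A x *\<^sub>R mat 1
       - real m *\<^sub>R (\<chi> i j. x $ i * tensor_vec m A x $ j)"

definition merit :: "nat \<Rightarrow> 'n::finite tensor \<Rightarrow> real^'n \<Rightarrow> real" where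
  "merit m A x = 1/2 * (norm (eqF m A x))\<^sup>2"

definition gradient :: "('a::real_inner \<Rightarrow> real) \<Rightarrow> 'a \<Rightarrow> 'a" where
  "gradient f x = (THE D. GDERIV f x :> D)"

text \<open>
  An \<open>n \<times> (n - 1)\<close> matrix, \<open>n = CARD('n)\<close>, is represented by its columns \<open>U 0, \<dots>, U (n - 2)\<close>:
  there is no index type of cardinality \<open>n - 1\<close> when \<open>n = 1\<close>. Thus the entries of \<open>U\<^sup>T v\<close> are
  \<open>U i \<bullet> v\<close>, and those of \<open>U\<^sup>T M U\<close> are \<open>U i \<bullet> (M *v U j)\<close>. The columns of an orthogonal basis need
  not have norm one.
\<close>

definition orthogonal_basis_compl :: "(nat \<Rightarrow> real^'n::finite) \<Rightarrow> real^'n \<Rightarrow> bool" where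
  "orthogonal_basis_compl U x \<longleftrightarrow>
     (\<forall>i<CARD('n) - 1. \<forall>j<CARD('n) - 1. i \<noteq> j \<longrightarrow> orthogonal (U i) (U j)) \<and>
     inj_on U {..<CARD('n) - 1} \<and>
     independent (U ` {..<CARD('n) - 1}) \<and>
     span (U ` {..<CARD('n) - 1}) = {d. x \<bullet> d = 0}"

definition posdef :: "nat \<Rightarrow> (nat \<Rightarrow> nat \<Rightarrow> real) \<Rightarrow> bool" where
  "posdef k M \<longleftrightarrow>
     (\<forall>z. (\<exists>i<k. z i \<noteq> 0) \<longrightarrow> (\<Sum>i<k. \<Sum>j<k. z i * M i j * z j) > 0)"

definition second_order_sufficient ::
    "nat \<Rightarrow> 'n::finite tensor \<Rightarrow> (nat \<Rightarrow> real^'n) \<Rightarrow> real^'n \<Rightarrow> bool" where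
  "second_order_sufficient m A U x \<longleftrightarrow>
     posdef (CARD('n) - 1) (\<lambda>i j. U i \<bullet> (jacF m A x *v U j))"

definition newton_direction ::
    "nat \<Rightarrow> 'n::finite tensor \<Rightarrow> (nat \<Rightarrow> real^'n) \<Rightarrow> real^'n \<Rightarrow> real^'n \<Rightarrow> bool" where
  "newton_direction m A U x d \<longleftrightarrow>
     (\<forall>i<CARD('n) - 1. U i \<bullet> (jacF m A x *v d) + U i \<bullet> eqF m A x = 0) \<and> x \<bullet> d = 0"

definition fallback_direction ::
    "nat \<Rightarrow> 'n::finite tensor \<Rightarrow> real \<Rightarrow> real^'n \<Rightarrow> real^'n \<Rightarrow> bool" where
  "fallback_direction m A \<mu> x d \<longleftrightarrow>
     d = - gradient (merit m A) x \<or>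
     (jacF m A x ** jacF m A x + (\<mu> * norm (eqF m A x)) *\<^sub>R mat 1) *v d
       + jacF m A x *v eqF m A x = 0"

definition trial :: "real^'n::finite \<Rightarrow> real^'n \<Rightarrow> real \<Rightarrow> real^'n" where
  "trial x d a = (x + a *\<^sub>R d) /\<^sub>R norm (x + a *\<^sub>R d)"

text \<open>
  The trial point is undefined when \<open>x + \<alpha> d = 0\<close>, which can happen for a fallback direction; such
  a step is not acceptable.
\<close>

definition acceptable ::
    "nat \<Rightarrow> 'n::finite tensor \<Rightarrow> real \<Rightarrow> real^'n \<Rightarrow> real^'n \<Rightarrow> real \<Rightarrow> bool" where
  "acceptable m A \<sigma> x d a \<longleftrightarrow>
     x + a *\<^sub>R d \<noteq> 0 \<and>
     merit m A (trial x d a) \<le> merit m A x + \<sigma> * a * (gradient (merit m A) x \<bullet> d)"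

text \<open>
  The infinite runs of the algorithm: iterates \<open>x\<close>, directions \<open>d\<close> and step sizes \<open>\<alpha>\<close>, where \<open>U y\<close>
  is the chosen basis matrix at the unit vector \<open>y\<close>. The step size is \<open>\<rho> ^ j\<close> for the least \<open>j\<close> that
  is acceptable.
\<close>

definition newton_run ::
    "nat \<Rightarrow> 'n::finite tensor \<Rightarrow> (real^'n \<Rightarrow> nat \<Rightarrow> real^'n) \<Rightarrow> real \<Rightarrow> real \<Rightarrow> real \<Rightarrow>
     (nat \<Rightarrow> real^'n) \<Rightarrow> (nat \<Rightarrow> real^'n) \<Rightarrow> (nat \<Rightarrow> real) \<Rightarrow> bool" where
  "newton_run m A U \<sigma> \<mu> \<rho> x d \<alpha> \<longleftrightarrow>
     x 0 \<bullet> x 0 = 1 \<and>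
     (\<forall>k. eqF m A (x k) \<noteq> 0 \<and>
          (if \<exists>v. newton_direction m A (U (x k)) (x k) v
           then newton_direction m A (U (x k)) (x k) (d k)
           else fallback_direction m A \<mu> (x k) (d k)) \<and>
          (\<exists>j. \<alpha> k = \<rho> ^ j \<and> acceptable m A \<sigma> (x k) (d k) (\<rho> ^ j) \<and>
               (\<forall>i<j. \<not> acceptable m A \<sigma> (x k) (d k) (\<rho> ^ i))) \<and>
          x (Suc k) = trial (x k) (d k) (\<alpha> k))"

end

theory Submission
  imports Defs
begin

text \<open>
  On the unit sphere \<open>F(x)\<close> is orthogonal to \<open>x\<close>, so a Newton direction \<open>d\<close> satisfies
  \<open>F'(x) d = - F(x) - (F(x) \<bullet> d) x\<close> and has slope \<open>\<nabla>\<theta>(x) \<bullet> d = - 2 \<theta>(x)\<close>. Near \<open>xbar\<close> the form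
  \<open>d \<mapsto> d \<bullet> F'(x) d\<close> is uniformly coercive on the complement of \<open>x\<close>; hence Newton directions exist
  and satisfy \<open>\<parallel>d\<parallel> \<le> c \<parallel>F(x)\<parallel>\<close>, and the line search yields step sizes bounded away from \<open>0\<close>. So
  \<open>\<theta>\<close> shrinks by a fixed factor at infinitely many iterations and never grows eventually, whence
  \<open>F(xbar) = 0\<close>. If \<open>\<sigma> < 1/2\<close>, a full step gives \<open>\<parallel>F(x\<^sub>k\<^sub>+\<^sub>1)\<parallel> \<le> M \<parallel>F(x\<^sub>k)\<parallel>\<^sup>2\<close>, so once the
  iterates are close enough to \<open>xbar\<close> full steps are accepted and \<open>\<parallel>x\<^sub>k - y\<parallel> + 4 c \<parallel>F(x\<^sub>k)\<parallel>\<close> is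
  decreasing in \<open>k\<close> for every \<open>y\<close>. With \<open>y = xbar\<close> this traps the iterates near \<open>xbar\<close>; with
  \<open>y = x\<^sub>j\<close> it gives, in the limit, the error bound \<open>\<parallel>x\<^sub>j - xbar\<parallel> \<le> 4 c \<parallel>F(x\<^sub>j)\<parallel>\<close> and thus the
  quadratic rate.
\<close>

section \<open>Homogeneous forms and the Jacobian\<close>

text \<open>The homogeneous form of degree \<open>r\<close> with coefficients \<open>B\<close>.
  Slices of \<open>A\<close> taken for \<open>B\<close> give the entries of
  \<open>tensor_vec\<close> and \<open>tensor_mat\<close>, so one derivative formula serves for all
  of them.\<close>

definition tform :: "nat \<Rightarrow> 'n::finite tensor \<Rightarrow> real^'n \<Rightarrow> real" where
  "tform r B x = (\<Sum>p | length p = r. B p * (\<Prod>k\<leftarrow>p. x $ k))"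

text \<open>Each index list splits uniquely into head and tail. The inductions on the degree rest on
  this recursion.\<close>

lemma tform_Suc: "tform (Suc r) B x = (\<Sum>j\<in>UNIV. x $ j * tform r (\<lambda>p. B (j # p)) x)"
proof -
  have "bij_betw (\<lambda>(j, p). j # p) (UNIV \<times> {p::'a list. length p = r}) {p. length p = Suc r}"
    by (rule bij_betwI[where g = "\<lambda>p. (hd p, tl p)"]) (auto simp: length_Suc_conv)
  then have "tform (Suc r) B x =
      (\<Sum>(j, p)\<in>UNIV \<times> {p. length p = r}. B (j # p) * (x $ j * (\<Prod>k\<leftarrow>p. x $ k)))"
    unfolding tform_def by (subst sum.reindex_bij_betw[symmetric]) (auto simp: case_prod_unfold)
  also have "\<dots> = (\<Sum>j\<in>UNIV. x $ j * tform r (\<lambda>p. B (j # p)) x)"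
    unfolding tform_def by (simp add: sum.cartesian_product[symmetric] sum_distrib_left ac_simps)
  finally show ?thesis .
qed

lemma tform_swap:
  assumes "symmetric_tensor (Suc (Suc r)) B"
  shows "tform r (\<lambda>p. B (i # j # p)) x = tform r (\<lambda>p. B (j # i # p)) x"
  unfolding tform_def
  by (rule sum.cong) (use assms in \<open>auto simp: symmetric_tensor_def add_mset_commute\<close>)

lemma symmetric_tensor_Cons:
  "symmetric_tensor (Suc r) B \<Longrightarrow> symmetric_tensor r (\<lambda>p. B (j # p))"
  by (auto simp: symmetric_tensor_def)

lemma tform_0: "tform 0 B x = B []"
  by (simp add: tform_def)

text \<open>Induction on the degree for all \<open>B\<close> at once, since a slice of a symmetric
  tensor is again symmetric. The product rule on \<open>tform_Suc\<close> gives the wanted sum once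
  from the outer factor and \<open>r\<close> times from the inner forms.\<close>

lemma has_derivative_tform:
  assumes "symmetric_tensor r B"
  shows "(tform r B has_derivative
           (\<lambda>h. real r * (\<Sum>j\<in>UNIV. h $ j * tform (r - 1) (\<lambda>p. B (j # p)) x))) (at x)"
  using assms
proof (induction r arbitrary: B)
  case 0
  show ?case unfolding tform_0[abs_def] by simp
next
  case (Suc r)
  let ?D = "\<lambda>j h. real r * (\<Sum>k\<in>UNIV. h $ k * tform (r - 1) (\<lambda>p. B (j # k # p)) x)"
  have "(tform r (\<lambda>p. B (j # p)) has_derivative ?D j) (at x)" for j
    using Suc.IH[OF symmetric_tensor_Cons[OF Suc.prems]] by simp
  moreover have "((\<lambda>x. x $ j) has_derivative (\<lambda>h. h $ j)) (at x)" for j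
    by (rule bounded_linear_imp_has_derivative) (rule bounded_linear_vec_nth)
  ultimately have "(tform (Suc r) B has_derivative
      (\<lambda>h. \<Sum>j\<in>UNIV. x $ j * ?D j h + h $ j * tform r (\<lambda>p. B (j # p)) x)) (at x)"
    unfolding tform_Suc[abs_def] by (intro has_derivative_sum has_derivative_mult)
  moreover have "(\<Sum>j\<in>UNIV. x $ j * ?D j h)
      = real r * (\<Sum>j\<in>UNIV. h $ j * tform r (\<lambda>p. B (j # p)) x)" for h
  \<comment> \<open>For \<open>r = 0\<close> both sides carry the factor \<open>0\<close>, so the
    truncated \<open>r - 1\<close> does no harm. Otherwise swapping the first two indices lets
    \<open>tform_Suc\<close> fold the inner sum back.\<close>
  proof (cases r)
    case (Suc s)
    have "(\<Sum>j\<in>UNIV. x $ j * ?D j h)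
      = real r * (\<Sum>j\<in>UNIV. \<Sum>k\<in>UNIV. h $ k * (x $ j * tform s (\<lambda>p. B (j # k # p)) x))"
      by (simp add: Suc sum_distrib_left ac_simps)
    also have "\<dots> = real r * (\<Sum>k\<in>UNIV. h $ k * (\<Sum>j\<in>UNIV. x $ j * tform s (\<lambda>p. B (k # j # p)) x))"
      using tform_swap[OF Suc.prems[unfolded Suc]]
      by (subst sum.swap) (simp add: sum_distrib_left)
    finally show ?thesis by (simp add: Suc tform_Suc)
  qed simp
  ultimately show ?case
    by (simp add: sum.distrib algebra_simps)
qed

lemma tensor_vec_nth: "tensor_vec m A x $ i = tform (m - 1) (\<lambda>p. A (i # p)) x"
  by (simp add: tensor_vec_def tform_def)

lemma tensor_mat_nth: "tensor_mat m A x $ i $ j = tform (m - 2) (\<lambda>p. A (i # j # p)) x"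
  by (simp add: tensor_mat_def tform_def)

lemma tensor_form_eq_tform: "m \<ge> 1 \<Longrightarrow> tensor_form m A x = tform m A x"
  by (cases m) (simp_all add: tensor_form_def inner_vec_def tensor_vec_nth tform_Suc)

text \<open>By symmetry, contracting the first index with \<open>x\<close> is the same as
  contracting the second, which leads back to \<open>tensor_vec\<close>.\<close>

lemma tensor_mat_left:
  assumes "m \<ge> 2" "symmetric_tensor m A"
  shows "x \<bullet> (tensor_mat m A x *v d) = tensor_vec m A x \<bullet> d"
proof -
  obtain s where m: "m = Suc (Suc s)" using assms(1) by (metis Suc_le_D numeral_2_eq_2 Suc_le_mono)
  have "x \<bullet> (tensor_mat m A x *v d)
      = (\<Sum>j\<in>UNIV. (\<Sum>i\<in>UNIV. x $ i * tform s (\<lambda>p. A (i # j # p)) x) * d $ j)"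
    by (simp add: inner_vec_def matrix_vector_mult_def tensor_mat_nth m sum_distrib_left
        sum_distrib_right ac_simps) (subst sum.swap, simp)
  also have "\<dots> = tensor_vec m A x \<bullet> d"
    using tform_swap[OF assms(2)[unfolded m]]
    by (simp add: inner_vec_def tensor_vec_nth m tform_Suc)
  finally show ?thesis .
qed

lemma has_derivative_tensor_form:
  assumes "m \<ge> 1" "symmetric_tensor m A"
  shows "(tensor_form m A has_derivative (\<lambda>h. real m * (tensor_vec m A x \<bullet> h))) (at x)"
proof -
  have "tensor_form m A = tform m A"
    using assms(1) by (simp add: fun_eq_iff tensor_form_eq_tform)
  then show ?thesis
    using has_derivative_tform[OF assms(2), of x]
    by (simp add: inner_vec_def tensor_vec_nth ac_simps)
qed

lemma has_derivative_vec:
  fixes f :: "'a::real_normed_vector \<Rightarrow> real^'n"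
  assumes "\<And>i. ((\<lambda>x. f x $ i) has_derivative (\<lambda>h. f' h $ i)) (at x within S)"
  shows "(f has_derivative f') (at x within S)"
  using assms by (subst has_derivative_componentwise_within) (auto simp: Basis_vec_def inner_axis)

lemma has_derivative_tensor_vec:
  assumes "m \<ge> 2" "symmetric_tensor m A"
  shows "(tensor_vec m A has_derivative (\<lambda>h. (real m - 1) *\<^sub>R (tensor_mat m A x *v h))) (at x)"
proof (rule has_derivative_vec)
  fix i
  have "symmetric_tensor (m - 1) (\<lambda>p. A (i # p))"
    using assms by (intro symmetric_tensor_Cons) (simp add: numeral_2_eq_2)
  from has_derivative_tform[OF this, of x] assms(1)
  show "((\<lambda>x. tensor_vec m A x $ i) has_derivative
      (\<lambda>h. ((real m - 1) *\<^sub>R (tensor_mat m A x *v h)) $ i)) (at x)"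
    by (simp add: tensor_vec_nth tensor_mat_nth matrix_vector_mult_def of_nat_diff
        numeral_2_eq_2 ac_simps)
qed

lemma jacF_mult:
  "jacF m A x *v h = (real m - 1) *\<^sub>R (tensor_mat m A x *v h) - tensor_form m A x *\<^sub>R h
     - (real m * (tensor_vec m A x \<bullet> h)) *\<^sub>R x"
proof -
  have "(\<chi> i j. x $ i * tensor_vec m A x $ j) *v h = (tensor_vec m A x \<bullet> h) *\<^sub>R x"
    by (simp add: vec_eq_iff matrix_vector_mult_def inner_vec_def sum_distrib_left
        sum_distrib_right ac_simps)
  then show ?thesis
    unfolding jacF_def
    by (simp add: matrix_vector_mult_diff_rdistrib scaleR_matrix_vector_assoc[symmetric])
qed

lemma has_derivative_eqF:
  assumes "m \<ge> 2" "symmetric_tensor m A"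
  shows "(eqF m A has_derivative (\<lambda>h. jacF m A x *v h)) (at x)"
proof -
  note [derivative_intros] = has_derivative_tensor_vec[OF assms]
    has_derivative_tensor_form[OF _ assms(2)]
  show ?thesis
    unfolding eqF_def[abs_def]
    by (rule has_derivative_eq_rhs, (rule derivative_intros)+)
       (use assms in \<open>auto simp: jacF_mult fun_eq_iff algebra_simps\<close>)
qed

section \<open>The merit function and its gradient\<close>

lemma has_derivative_merit:
  assumes "m \<ge> 2" "symmetric_tensor m A"
  shows "(merit m A has_derivative (\<lambda>h. eqF m A x \<bullet> (jacF m A x *v h))) (at x)"
  unfolding merit_def[abs_def] power2_norm_eq_inner
  by (rule has_derivative_eq_rhs, (rule derivative_intros has_derivative_eqF[OF assms])+)
     (simp add: fun_eq_iff inner_commute)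

text \<open>The Riesz representative \<open>adjoint f' 1\<close> is a gradient, and uniqueness of
  the derivative makes it the only one; hence the definite description in \<open>gradient\<close>
  denotes it.\<close>

lemma gradient_inner:
  fixes f :: "'a::euclidean_space \<Rightarrow> real"
  assumes "(f has_derivative f') (at x)"
  shows "gradient f x \<bullet> h = f' h"
proof -
  interpret bounded_linear f' using assms by (rule has_derivative_bounded_linear)
  let ?D = "adjoint f' 1"
  have D: "h \<bullet> ?D = f' h" for h
    using adjoint_works[OF linear_axioms, of h 1] by simp
  then have "GDERIV f x :> ?D"
    using assms by (simp add: gderiv_def)
  moreover have "E = ?D" if "GDERIV f x :> E" for E
  proof -
    have "(\<lambda>h. h \<bullet> E) = f'"
      using that assms by (intro has_derivative_unique) (simp_all add: gderiv_def)
    then have "h \<bullet> (E - ?D) = 0" for h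
      using D by (simp add: inner_diff_right fun_eq_iff)
    then show ?thesis by (metis eq_iff_diff_eq_0 inner_eq_zero_iff)
  qed
  ultimately have "gradient f x = ?D"
    unfolding gradient_def by (rule the_equality)
  then show ?thesis using D by (simp add: inner_commute)
qed

lemma gradient_merit:
  assumes "m \<ge> 2" "symmetric_tensor m A"
  shows "gradient (merit m A) x \<bullet> h = eqF m A x \<bullet> (jacF m A x *v h)"
  using gradient_inner[OF has_derivative_merit[OF assms]] .

lemma eqF_orthogonal:
  "x \<bullet> x = 1 \<Longrightarrow> x \<bullet> eqF m A x = 0"
  by (simp add: eqF_def inner_diff_right tensor_form_def)

text \<open>This is \<open>x \<bullet> eqF m A x = 0\<close> differentiated along the sphere; in
  coordinates, the factors \<open>m - 1\<close> and \<open>- m\<close> of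
  \<open>tensor_vec m A x \<bullet> h\<close> add up to \<open>- 1\<close>. It supplies the radial
  component that the Newton equations leave open.\<close>

lemma jacF_radial:
  assumes "m \<ge> 2" "symmetric_tensor m A" "x \<bullet> x = 1" "x \<bullet> h = 0"
  shows "x \<bullet> (jacF m A x *v h) = - (eqF m A x \<bullet> h)"
  using assms(3,4)
  by (simp add: jacF_mult eqF_def inner_diff_right inner_diff_left
      tensor_mat_left[OF assms(1,2)] algebra_simps)

section \<open>Quadratic Taylor remainders of polynomial functions\<close>

text \<open>The four bounds are bundled because the remainder of a product involves values,
  derivatives and increments of both factors. They are stated for pairs of points of
  \<open>S\<close> rather than along segments, so that \<open>S\<close> may be the sphere, which is
  not convex.\<close>

definition quadratic_remainder ::
    "'a::real_normed_vector set \<Rightarrow> ('a \<Rightarrow> 'b::real_normed_vector) \<Rightarrow> ('a \<Rightarrow> 'a \<Rightarrow> 'b) \<Rightarrow> real \<Rightarrow> bool" where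
  "quadratic_remainder S f D B \<longleftrightarrow>
    (\<forall>x. (f has_derivative D x) (at x)) \<and>
    (\<forall>x\<in>S. norm (f x) \<le> B \<and> (\<forall>h. norm (D x h) \<le> B * norm h) \<and>
      (\<forall>y\<in>S. norm (f y - f x) \<le> B * norm (y - x) \<and>
        norm (f y - f x - D x (y - x)) \<le> B * (norm (y - x))\<^sup>2))"

lemma quadratic_remainderD:
  assumes "quadratic_remainder S f D B"
  shows "(f has_derivative D x) (at x)" "x \<in> S \<Longrightarrow> norm (f x) \<le> B"
    "x \<in> S \<Longrightarrow> norm (D x h) \<le> B * norm h"
    "\<lbrakk>x \<in> S; y \<in> S\<rbrakk> \<Longrightarrow> norm (f y - f x) \<le> B * norm (y - x)"
    "\<lbrakk>x \<in> S; y \<in> S\<rbrakk> \<Longrightarrow> norm (f y - f x - D x (y - x)) \<le> B * (norm (y - x))\<^sup>2"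
  using assms by (auto simp: quadratic_remainder_def)

lemma quadratic_remainder_linear:
  assumes "bounded_linear f" "bounded S"
  shows "\<exists>B. quadratic_remainder S f (\<lambda>x. f) B"
proof -
  interpret bounded_linear f by fact
  obtain K where K: "K > 0" "\<And>x. norm (f x) \<le> norm x * K" using pos_bounded by blast
  obtain R where R: "\<And>x. x \<in> S \<Longrightarrow> norm x \<le> R" using assms(2) by (auto simp: bounded_iff)
  \<comment> \<open>One constant must bound the values on \<open>S\<close>, which takes
    \<open>K * R\<close>, and the increments, which takes \<open>K\<close>. The remainder is
    zero.\<close>
  define B where "B = K * max R 1"
  have "K * 1 \<le> B" unfolding B_def using K(1) by (intro mult_left_mono) auto
  then have "norm (f h) \<le> B * norm h" for h
    using K(2)[of h] mult_right_mono[of K B "norm h"] by (simp add: mult.commute)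
  moreover have "norm (f x) \<le> B" if "x \<in> S" for x
  proof -
    have "K * norm x \<le> B"
      unfolding B_def using K(1) R[OF that] by (intro mult_left_mono) auto
    then show ?thesis using K(2)[of x] by (simp add: mult.commute)
  qed
  moreover have "B \<ge> 0" using K(1) \<open>K * 1 \<le> B\<close> by simp
  ultimately show ?thesis
    unfolding quadratic_remainder_def diff[symmetric]
    using bounded_linear_imp_has_derivative[OF assms(1)]
    by (intro exI[of _ B]) auto
qed

lemma quadratic_remainder_const: "quadratic_remainder S (\<lambda>x. c) (\<lambda>x h. 0) (norm c)"
  by (simp add: quadratic_remainder_def)

lemma quadratic_remainder_add:
  assumes f: "quadratic_remainder S f D B" and g: "quadratic_remainder S g D' B'"
  shows "quadratic_remainder S (\<lambda>x. f x + g x) (\<lambda>x h. D x h + D' x h) (B + B')"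
  unfolding quadratic_remainder_def
proof (intro conjI ballI allI)
  note F = quadratic_remainderD[OF f] and G = quadratic_remainderD[OF g]
  show "((\<lambda>x. f x + g x) has_derivative (\<lambda>h. D x h + D' x h)) (at x)" for x
    by (intro has_derivative_add F G)
  fix x assume x: "x \<in> S"
  show "norm (f x + g x) \<le> B + B'"
    using F(2)[OF x] G(2)[OF x] by norm
  show "norm (D x h + D' x h) \<le> (B + B') * norm h" for h
    using norm_triangle_mono[OF F(3)[OF x] G(3)[OF x], of h h] by (simp add: distrib_right)
  fix y assume y: "y \<in> S"
  show "norm (f y + g y - (f x + g x)) \<le> (B + B') * norm (y - x)"
    using norm_triangle_mono[OF F(4)[OF x y] G(4)[OF x y]] by (simp add: algebra_simps)
  show "norm (f y + g y - (f x + g x) - (D x (y - x) + D' x (y - x)))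
      \<le> (B + B') * (norm (y - x))\<^sup>2"
    using norm_triangle_mono[OF F(5)[OF x y] G(5)[OF x y]] by (simp add: algebra_simps)
qed

text \<open>The remainder of a product is a sum of three terms, each at most \<open>B * B'\<close>
  times the squared distance; hence the factor 3.\<close>

lemma quadratic_remainder_mult:
  fixes f g :: "'a::real_normed_vector \<Rightarrow> real"
  assumes f: "quadratic_remainder S f D B" and g: "quadratic_remainder S g D' B'"
  shows "quadratic_remainder S (\<lambda>x. f x * g x) (\<lambda>x h. f x * D' x h + D x h * g x) (3 * B * B')"
  unfolding quadratic_remainder_def
proof (intro conjI ballI allI)
  note F = quadratic_remainderD[OF f] and G = quadratic_remainderD[OF g]
  let ?D = "\<lambda>x h. f x * D' x h + D x h * g x"
  show "((\<lambda>x. f x * g x) has_derivative ?D x) (at x)" for x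
    by (intro has_derivative_mult F G)
  fix x assume x: "x \<in> S"
  have B: "0 \<le> B" "0 \<le> B'"
    using F(2)[OF x] G(2)[OF x] norm_ge_zero order_trans by blast+
  then have BB: "0 \<le> B * B'" by simp
  have mono: "norm (a * b) \<le> s * t" if "norm a \<le> s" "norm b \<le> t" for a b s t :: real
    using that unfolding norm_mult
    by (intro mult_mono) (auto intro: order_trans[OF norm_ge_zero])
  show "norm (f x * g x) \<le> 3 * B * B'"
    using mono[OF F(2)[OF x] G(2)[OF x]] BB by linarith
  show "norm (?D x h) \<le> 3 * B * B' * norm h" for h
  proof -
    have "norm (?D x h) \<le> B * (B' * norm h) + B * norm h * B'"
      by (intro norm_triangle_mono mono F G x)
    also have "\<dots> = 2 * (B * B' * norm h)" by simp
    also have "\<dots> \<le> 3 * (B * B' * norm h)" using BB by (intro mult_right_mono) auto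
    finally show ?thesis by (simp add: mult.assoc)
  qed
  fix y assume y: "y \<in> S"
  let ?n = "norm (y - x)"
  have "f y * g y - f x * g x = f y * (g y - g x) + (f y - f x) * g x"
    by (simp add: algebra_simps)
  also have "norm \<dots> \<le> B * (B' * ?n) + B * ?n * B'"
    by (intro norm_triangle_mono mono F G x y)
  also have "\<dots> = 2 * (B * B' * ?n)" by simp
  also have "\<dots> \<le> 3 * (B * B' * ?n)" using BB by (intro mult_right_mono) auto
  finally show "norm (f y * g y - f x * g x) \<le> 3 * B * B' * ?n" by (simp add: mult.assoc)
  have "f y * g y - f x * g x - ?D x (y - x) = f x * (g y - g x - D' x (y - x))
     + (f y - f x - D x (y - x)) * g x + (f y - f x) * (g y - g x)"
    by (simp add: algebra_simps)
  also have "norm \<dots> \<le> B * (B' * ?n\<^sup>2) + B * ?n\<^sup>2 * B' + (B * ?n) * (B' * ?n)"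
    by (intro norm_triangle_mono mono F G x y)
  also have "\<dots> = 3 * B * B' * ?n\<^sup>2" by (simp add: power2_eq_square)
  finally show "norm (f y * g y - f x * g x - ?D x (y - x)) \<le> 3 * B * B' * ?n\<^sup>2" .
qed

lemma real_polynomial_function_quadratic_remainder:
  assumes "real_polynomial_function f" "bounded S"
  shows "\<exists>D B. quadratic_remainder S f D B"
  using assms(1)
proof induction
  case (linear f)
  then show ?case using quadratic_remainder_linear assms(2) by blast
qed (use quadratic_remainder_const quadratic_remainder_add quadratic_remainder_mult in blast)+

text \<open>Coordinatewise from the real case. The induction over polynomials yields some
  derivative, which uniqueness identifies with the given \<open>D\<close>.\<close>

lemma polynomial_function_quadratic_remainder:
  fixes f :: "'a::euclidean_space \<Rightarrow> 'b::euclidean_space"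
  assumes "polynomial_function f" "bounded S" and D: "\<And>x. (f has_derivative D x) (at x)"
  shows "\<exists>C>0. quadratic_remainder S f D C"
proof -
  have "\<exists>B. quadratic_remainder S (\<lambda>x. f x \<bullet> b) (\<lambda>x h. D x h \<bullet> b) B" if "b \<in> Basis" for b
  proof -
    have "real_polynomial_function (\<lambda>x. f x \<bullet> b)"
      using assms(1) that by (simp add: polynomial_function_iff_Basis_inner)
    from real_polynomial_function_quadratic_remainder[OF this assms(2)]
    obtain D' B where D': "quadratic_remainder S (\<lambda>x. f x \<bullet> b) D' B"
      by blast
    have "D' x = (\<lambda>h. D x h \<bullet> b)" for x
      using quadratic_remainderD(1)[OF D'] has_derivative_inner_left[OF D]
      by (rule has_derivative_unique)
    then have "D' = (\<lambda>x h. D x h \<bullet> b)" by auto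
    then show ?thesis using D' by blast
  qed
  then obtain B where
    "\<And>b. b \<in> Basis \<Longrightarrow> quadratic_remainder S (\<lambda>x. f x \<bullet> b) (\<lambda>x h. D x h \<bullet> b) (B b)"
    by metis
  note B = quadratic_remainderD[OF this]
  \<comment> \<open>The sum comes from bounding the norm by the sum of absolute coordinates; the
    maximum makes \<open>C\<close> positive.\<close>
  define C where "C = max 1 (\<Sum>b\<in>Basis. B b)"
  have norm_le: "norm v \<le> C * t" if "t \<ge> 0" "\<And>b. b \<in> Basis \<Longrightarrow> \<bar>v \<bullet> b\<bar> \<le> B b * t" for v :: 'b and t
  proof -
    have "(\<Sum>b\<in>Basis. \<bar>v \<bullet> b\<bar>) \<le> (\<Sum>b\<in>Basis. B b) * t"
      unfolding sum_distrib_right using that(2) by (rule sum_mono)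
    moreover have "\<dots> \<le> C * t" using that(1) by (intro mult_right_mono) (simp_all add: C_def)
    ultimately show ?thesis using norm_le_l1[of v] by linarith
  qed
  have "quadratic_remainder S f D C"
    unfolding quadratic_remainder_def
  proof (intro conjI ballI allI D)
    fix x assume x: "x \<in> S"
    show "norm (f x) \<le> C"
      using norm_le[of 1 "f x"] B(2)[OF _ x] by simp
    show "norm (D x h) \<le> C * norm h" for h
      using B(3)[OF _ x] by (intro norm_le) simp_all
    fix y assume y: "y \<in> S"
    show "norm (f y - f x) \<le> C * norm (y - x)"
      using B(4)[OF _ x y] by (intro norm_le) (simp_all add: inner_diff_left)
    show "norm (f y - f x - D x (y - x)) \<le> C * (norm (y - x))\<^sup>2"
      using B(5)[OF _ x y] by (intro norm_le) (simp_all add: inner_diff_left)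
  qed
  then show ?thesis
    by (intro exI[of _ C]) (simp add: C_def)
qed

text \<open>By Pythagoras the norm \<open>s\<close> of the unnormalised point satisfies
  \<open>s\<^sup>2 = 1 + (norm (a *\<^sub>R d))\<^sup>2\<close>. Normalising moves that point by
  \<open>s - 1\<close>, which is at most \<open>s\<^sup>2 - 1\<close>, a second order
  effect.\<close>

lemma trial_estimates:
  assumes "x \<bullet> x = 1" "x \<bullet> d = 0"
  shows "norm (x + a *\<^sub>R d) \<ge> 1"
    and "norm (trial x d a) = 1"
    and "norm (trial x d a - x) \<le> 2 * norm (a *\<^sub>R d)"
    and "norm (trial x d a - (x + a *\<^sub>R d)) \<le> (norm (a *\<^sub>R d))\<^sup>2"
proof -
  let ?v = "x + a *\<^sub>R d" and ?e = "norm (a *\<^sub>R d)"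
  define s where "s = norm ?v"
  have s2: "s\<^sup>2 = 1 + ?e\<^sup>2"
    unfolding s_def power2_norm_eq_inner using assms
    by (simp add: inner_add_left inner_add_right inner_commute)
  have "1\<^sup>2 \<le> s\<^sup>2" by (simp add: s2)
  then show s: "norm ?v \<ge> 1" unfolding s_def by (rule power2_le_imp_le) simp
  then show "norm (trial x d a) = 1" by (simp add: trial_def) (metis left_inverse not_one_le_zero)
  have x: "norm x = 1" using assms(1) by (simp add: norm_eq_1)
  have "trial x d a - ?v = (inverse s - 1) *\<^sub>R ?v"
    by (simp add: trial_def s_def scaleR_diff_left)
  then have "norm (trial x d a - ?v) = \<bar>inverse s - 1\<bar> * s" by (simp add: s_def)
  also have "\<dots> = s - 1"
    using s unfolding s_def[symmetric] by (simp add: field_simps abs_if)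
  finally have eq: "norm (trial x d a - ?v) = s - 1" .
  have "s - 1 \<le> (s - 1) * (s + 1)"
    using s unfolding s_def[symmetric] by (simp add: mult_le_cancel_left1)
  also have "\<dots> = ?e\<^sup>2" using s2 by (simp add: algebra_simps power2_eq_square)
  finally show "norm (trial x d a - ?v) \<le> ?e\<^sup>2" using eq by simp
  have "s - 1 \<le> ?e" using norm_triangle_ineq[of x "a *\<^sub>R d"] x by (simp add: s_def)
  then show "norm (trial x d a - x) \<le> 2 * ?e"
    using norm_triangle_ineq[of "trial x d a - ?v" "a *\<^sub>R d"] eq by (simp add: algebra_simps)
qed

text \<open>Both \<open>x\<close> and its trial point lie on the sphere, so a single Taylor constant
  \<open>C\<close> works for every step. The displacement \<open>2 * norm (a *\<^sub>R d)\<close>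
  contributes \<open>4 * C\<close> and the normalisation error another \<open>C\<close>.\<close>

lemma polynomial_function_trial_remainder:
  fixes f :: "real^'n \<Rightarrow> 'b::euclidean_space"
  assumes "polynomial_function f" and D: "\<And>x. (f has_derivative D x) (at x)"
  shows "\<exists>C>0. \<forall>x d a. x \<bullet> x = 1 \<longrightarrow> x \<bullet> d = 0 \<longrightarrow>
    norm (f (trial x d a) - f x - a *\<^sub>R D x d) \<le> C * (norm (a *\<^sub>R d))\<^sup>2"
proof -
  obtain C where "C > 0" and R: "quadratic_remainder (sphere 0 1) f D C"
    using polynomial_function_quadratic_remainder[OF assms(1) bounded_sphere D] by blast
  note C = \<open>C > 0\<close> quadratic_remainderD(3,5)[OF R]
  have "norm (f (trial x d a) - f x - a *\<^sub>R D x d) \<le> (5 * C) * (norm (a *\<^sub>R d))\<^sup>2"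
    if x: "x \<bullet> x = 1" "x \<bullet> d = 0" for x d a
  proof -
    interpret bounded_linear "D x" by (rule has_derivative_bounded_linear[OF D])
    let ?t = "trial x d a" and ?e = "norm (a *\<^sub>R d)"
    note t = trial_estimates[OF x, of a]
    have S: "x \<in> sphere 0 1" "?t \<in> sphere 0 1" using t(2) x(1) by (auto simp: norm_eq_1)
    have "norm (f ?t - f x - D x (?t - x)) \<le> C * (2 * ?e)\<^sup>2"
      using C(3)[OF S] by (rule order_trans) (use C(1) t(3) in \<open>intro mult_left_mono power_mono; simp\<close>)
    moreover have "norm (D x (?t - (x + a *\<^sub>R d))) \<le> C * ?e\<^sup>2"
      using C(2)[OF S(1)] by (rule order_trans) (use C(1) t(4) in \<open>intro mult_left_mono; simp\<close>)
    moreover have "f ?t - f x - a *\<^sub>R D x d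
        = (f ?t - f x - D x (?t - x)) + D x (?t - (x + a *\<^sub>R d))"
      by (simp add: diff add scaleR)
    ultimately have "norm (f ?t - f x - a *\<^sub>R D x d) \<le> C * (2 * ?e)\<^sup>2 + C * ?e\<^sup>2"
      by (simp only:) (rule norm_triangle_mono)
    then show ?thesis by (simp add: power_mult_distrib)
  qed
  then show ?thesis using C(1) by (intro exI[of _ "5 * C"]) simp
qed

section \<open>The tensor maps are polynomial\<close>

lemma real_polynomial_function_tform: "real_polynomial_function (tform r B)"
proof -
  have "real_polynomial_function (\<lambda>x::real^'a. \<Prod>k\<leftarrow>p. x $ k)" for p
    by (induction p)
      (simp_all add: real_polynomial_function.intros bounded_linear_vec_nth)
  then show ?thesis
    unfolding tform_def[abs_def] using finite_lists_length_eq[OF finite_class.finite_UNIV, of r]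
    by (intro real_polynomial_function_sum real_polynomial_function.intros(2,4)) auto
qed

lemma polynomial_function_vec:
  fixes f :: "'a::real_normed_vector \<Rightarrow> real^'n"
  assumes "\<And>i. real_polynomial_function (\<lambda>x. f x $ i)"
  shows "polynomial_function f"
  using assms by (auto simp: polynomial_function_iff_Basis_inner Basis_vec_def inner_axis)

lemma real_polynomial_function_inner:
  fixes f g :: "'a::real_normed_vector \<Rightarrow> real^'n"
  assumes "polynomial_function f" "polynomial_function g"
  shows "real_polynomial_function (\<lambda>x. f x \<bullet> g x)"
proof -
  have "real_polynomial_function (\<lambda>x. h x $ i)" if "polynomial_function h" for h :: "'a \<Rightarrow> real^'n" and i
    using that bounded_linear_vec_nth[of i] unfolding polynomial_function_def by (force simp: o_def)
  then show ?thesis using assms unfolding inner_vec_def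
    by (auto intro!: real_polynomial_function_sum real_polynomial_function.intros(4))
qed

lemma polynomial_function_tensor_vec: "polynomial_function (tensor_vec m A)"
  by (rule polynomial_function_vec) (simp add: tensor_vec_nth real_polynomial_function_tform)

lemma real_polynomial_function_tensor_form: "real_polynomial_function (tensor_form m A)"
  unfolding tensor_form_def[abs_def]
  by (intro real_polynomial_function_inner polynomial_function_tensor_vec polynomial_function_id)

lemma polynomial_function_eqF: "polynomial_function (eqF m A)"
  unfolding eqF_def[abs_def]
  using polynomial_function_tensor_vec real_polynomial_function_tensor_form
  by (intro polynomial_function_diff polynomial_function_mult)
    (auto simp: real_polynomial_function_eq)

lemma polynomial_function_merit: "polynomial_function (merit m A)"
  unfolding merit_def[abs_def] power2_norm_eq_inner real_polynomial_function_eq[symmetric]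
  by (intro real_polynomial_function.intros(2,4)
      real_polynomial_function_inner polynomial_function_eqF)

section \<open>Newton directions\<close>

lemma tendsto_polynomial_function:
  fixes f :: "'a::euclidean_space \<Rightarrow> 'b::euclidean_space"
  assumes "polynomial_function f" "(X \<longlongrightarrow> x) F"
  shows "((\<lambda>k. f (X k)) \<longlongrightarrow> f x) F"
  using continuous_polymonial_function[OF assms(1)] assms(2) by (rule isCont_tendsto_compose)

lemma tendsto_jacF_mult:
  assumes X: "(X \<longlongrightarrow> x) F" and v: "(v \<longlongrightarrow> w) F"
  shows "((\<lambda>k. jacF m A (X k) *v v k) \<longlongrightarrow> jacF m A x *v w) F"
proof -
  have tform: "((\<lambda>k. tform r B (X k)) \<longlongrightarrow> tform r B x) F" for r B
    using real_polynomial_function_tform X unfolding real_polynomial_function_eq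
    by (rule tendsto_polynomial_function)
  have "((\<lambda>k. tensor_mat m A (X k) *v v k) \<longlongrightarrow> tensor_mat m A x *v w) F"
    unfolding matrix_vector_mult_def tensor_mat_nth by (intro tendsto_intros tform X v)
  moreover have "((\<lambda>k. tensor_vec m A (X k)) \<longlongrightarrow> tensor_vec m A x) F"
    by (rule tendsto_polynomial_function[OF polynomial_function_tensor_vec X])
  moreover have "((\<lambda>k. tensor_form m A (X k)) \<longlongrightarrow> tensor_form m A x) F"
    using real_polynomial_function_tensor_form X unfolding real_polynomial_function_eq
    by (rule tendsto_polynomial_function)
  ultimately show ?thesis unfolding jacF_mult by (intro tendsto_intros X v)
qed

text \<open>Compactness of the unit sphere: otherwise unit vectors orthogonal to points tending to
  \<open>xb\<close> would violate coercivity with constants tending to 0, and a limit of them would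
  be a unit vector orthogonal to \<open>xb\<close> on which the form is not positive. The complement
  of \<open>x\<close> varies with \<open>x\<close>, hence the sequences in both arguments.\<close>

lemma jacF_locally_coercive:
  fixes xb :: "real^'n"
  assumes pos: "\<And>w. \<lbrakk>xb \<bullet> w = 0; w \<noteq> 0\<rbrakk> \<Longrightarrow> w \<bullet> (jacF m A xb *v w) > 0"
  shows "\<exists>c>0. \<exists>r>0. \<forall>x v. dist x xb < r \<longrightarrow> x \<bullet> v = 0 \<longrightarrow>
    c * (norm v)\<^sup>2 \<le> v \<bullet> (jacF m A x *v v)"
proof (rule ccontr)
  assume neg: "\<not> ?thesis"
  have "\<exists>x v. dist x xb < 1 / real (Suc n) \<and> x \<bullet> v = 0 \<and>
    v \<bullet> (jacF m A x *v v) < 1 / real (Suc n) * (norm v)\<^sup>2" for n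
    using neg by (metis not_le of_nat_0_less_iff zero_less_Suc zero_less_divide_1_iff)
  then obtain X V where X: "\<And>n. dist (X n) xb < 1 / real (Suc n)"
    and V: "\<And>n. X n \<bullet> V n = 0"
    and XV: "\<And>n. V n \<bullet> (jacF m A (X n) *v V n) < 1 / real (Suc n) * (norm (V n))\<^sup>2"
    by metis
  define E where "E n = V n /\<^sub>R norm (V n)" for n
  \<comment> \<open>The strict inequality in \<open>XV\<close> excludes the zero vector, so the
    normalisation is legitimate.\<close>
  have nz: "V n \<noteq> 0" for n using XV[of n] by auto
  have "E n \<in> sphere 0 1" for n using nz[of n] by (simp add: E_def)
  then obtain e s where e: "e \<in> sphere 0 1" and s: "strict_mono s" and lim: "(E \<circ> s) \<longlonglongrightarrow> e"
    using compact_sphere[of "0::real^'n" 1] unfolding compact_def by metis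
  have inv0: "(\<lambda>n. 1 / real (Suc n)) \<longlonglongrightarrow> 0"
    using LIMSEQ_inverse_real_of_nat by (simp add: inverse_eq_divide)
  have "(\<lambda>n. dist (X n) xb) \<longlonglongrightarrow> 0"
    by (rule tendsto_sandwich[OF _ _ tendsto_const inv0]) (use X in \<open>auto intro!: always_eventually less_imp_le simp del: of_nat_Suc\<close>)
  then have Xs: "(\<lambda>n. X (s n)) \<longlonglongrightarrow> xb"
    using LIMSEQ_subseq_LIMSEQ[OF _ s] tendsto_dist_iff by (fastforce simp: o_def)
  have Es: "(\<lambda>n. E (s n)) \<longlonglongrightarrow> e" using lim by (simp add: o_def)
  have "X n \<bullet> E n = 0" for n using V[of n] by (simp add: E_def)
  then have "(\<lambda>n. 0) \<longlonglongrightarrow> xb \<bullet> e" using tendsto_inner[OF Xs Es] by simp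
  then have perp: "xb \<bullet> e = 0" by (simp add: LIMSEQ_const_iff)
  have "E n \<bullet> (jacF m A (X n) *v E n) \<le> 1 / real (Suc n)" for n
  proof -
    have "E n \<bullet> (jacF m A (X n) *v E n) = (V n \<bullet> (jacF m A (X n) *v V n)) / (norm (V n))\<^sup>2"
      by (simp add: E_def matrix_vector_mult_scaleR power2_eq_square divide_inverse)
    also have "\<dots> \<le> 1 / real (Suc n)"
      using XV[of n] nz[of n] by (simp add: pos_divide_le_eq less_imp_le)
    finally show ?thesis .
  qed
  moreover have "(\<lambda>n. E (s n) \<bullet> (jacF m A (X (s n)) *v E (s n))) \<longlonglongrightarrow> e \<bullet> (jacF m A xb *v e)"
    by (intro tendsto_inner tendsto_jacF_mult Xs Es)
  moreover have "(\<lambda>n. 1 / real (Suc (s n))) \<longlonglongrightarrow> 0"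
    using LIMSEQ_subseq_LIMSEQ[OF inv0 s] by (simp add: o_def)
  ultimately have "e \<bullet> (jacF m A xb *v e) \<le> 0"
    by (blast intro: LIMSEQ_le)
  moreover have "e \<noteq> 0" using e by auto
  ultimately show False using pos[OF perp] by fastforce
qed

text \<open>Expanding \<open>w\<close> in the basis turns the form of the reduced matrix into that
  of \<open>jacF\<close>. The arguments at \<open>xbar\<close> thereby become independent of the
  chosen basis.\<close>

lemma second_order_sufficient_positive:
  fixes x :: "real^'n"
  assumes sos: "second_order_sufficient m A U x" and U: "orthogonal_basis_compl U x"
    and w: "x \<bullet> w = 0" "w \<noteq> 0"
  shows "w \<bullet> (jacF m A x *v w) > 0"
proof -
  let ?I = "{..<CARD('n) - 1}"
  have "w \<in> span (U ` ?I)" using U w by (simp add: orthogonal_basis_compl_def)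
  then obtain u where "w = (\<Sum>v\<in>U ` ?I. u v *\<^sub>R v)" by (auto simp: span_finite)
  \<comment> \<open>Injectivity of \<open>U\<close> allows passing from the set of columns to their
    indices.\<close>
  also have "\<dots> = (\<Sum>i\<in>?I. u (U i) *\<^sub>R U i)"
    using U by (subst sum.reindex) (auto simp: orthogonal_basis_compl_def)
  finally have w_eq: "w = (\<Sum>i\<in>?I. u (U i) *\<^sub>R U i)" .
  then have "\<exists>i<CARD('n) - 1. u (U i) \<noteq> 0"
    using w(2) by (auto intro!: sum.neutral)
  then have "0 < (\<Sum>i\<in>?I. \<Sum>j\<in>?I. u (U i) * (U i \<bullet> (jacF m A x *v U j)) * u (U j))"
    using sos unfolding second_order_sufficient_def posdef_def by (metis (mono_tags))
  also have "\<dots> = w \<bullet> (jacF m A x *v w)"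
  proof -
    have J: "jacF m A x *v w = (\<Sum>j\<in>?I. u (U j) *\<^sub>R (jacF m A x *v U j))"
      by (subst w_eq) (simp add: linear_sum[OF matrix_vector_mul_linear] o_def
          matrix_vector_mult_scaleR)
    have "w \<bullet> (jacF m A x *v w)
        = (\<Sum>i\<in>?I. u (U i) *\<^sub>R U i) \<bullet> (\<Sum>j\<in>?I. u (U j) *\<^sub>R (jacF m A x *v U j))"
      by (subst J, subst (1) w_eq) (rule refl)
    also have "\<dots> = (\<Sum>i\<in>?I. \<Sum>j\<in>?I. u (U i) * (u (U j) * (U i \<bullet> (jacF m A x *v U j))))"
      by (simp only: inner_sum_left inner_scaleR_left)
        (simp only: inner_sum_right inner_scaleR_right sum_distrib_left)
    finally show ?thesis
      by (auto intro!: sum.cong)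
  qed
  finally show ?thesis .
qed

text \<open>The Newton equations say that the residual \<open>?R\<close> has no component orthogonal
  to \<open>x\<close>; its component along \<open>x\<close> is known from
  \<open>jacF_radial\<close>. This gives a form without basis.\<close>

lemma newton_direction_iff:
  fixes x :: "real^'n"
  assumes U: "orthogonal_basis_compl U x" and x: "x \<bullet> x = 1"
    and m: "m \<ge> 2" "symmetric_tensor m A"
  shows "newton_direction m A U x v \<longleftrightarrow>
    x \<bullet> v = 0 \<and> jacF m A x *v v = - eqF m A x - (eqF m A x \<bullet> v) *\<^sub>R x"
proof -
  let ?R = "jacF m A x *v v + eqF m A x"
  let ?I = "{..<CARD('n) - 1}"
  have span: "span (U ` ?I) = {v. x \<bullet> v = 0}"
    using U by (simp add: orthogonal_basis_compl_def)
  have "(\<forall>i\<in>?I. U i \<bullet> ?R = 0) \<longleftrightarrow> ?R = - ((eqF m A x \<bullet> v) *\<^sub>R x)" if v: "x \<bullet> v = 0"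
  proof
    assume R: "\<forall>i\<in>?I. U i \<bullet> ?R = 0"
    have xR: "x \<bullet> ?R = - (eqF m A x \<bullet> v)"
      using jacF_radial[OF m x v] eqF_orthogonal[OF x] by (simp add: inner_add_right)
    \<comment> \<open>The part of \<open>?R\<close> orthogonal to \<open>x\<close>. It is orthogonal
      both to \<open>?R\<close> and to \<open>x\<close>, hence to itself.\<close>
    define w where "w = ?R - (x \<bullet> ?R) *\<^sub>R x"
    have "w \<in> span (U ` ?I)" unfolding span w_def using x by (simp add: inner_diff_right)
    then have "orthogonal ?R w"
      by (rule orthogonal_to_span) (use R in \<open>auto simp: orthogonal_def inner_commute\<close>)
    moreover have "x \<bullet> w = 0" unfolding w_def using x by (simp add: inner_diff_right)
    ultimately have "w \<bullet> w = 0"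
      by (subst (1) w_def) (simp add: inner_diff_left orthogonal_def)
    then show "?R = - ((eqF m A x \<bullet> v) *\<^sub>R x)"
      using xR by (simp add: w_def eq_neg_iff_add_eq_0)
  next
    have "x \<bullet> U i = 0" if "i \<in> ?I" for i
      using that span span_base[of "U i" "U ` ?I"] by blast
    then show "?R = - ((eqF m A x \<bullet> v) *\<^sub>R x) \<Longrightarrow> \<forall>i\<in>?I. U i \<bullet> ?R = 0"
      by (simp add: inner_commute)
  qed
  moreover have "newton_direction m A U x v \<longleftrightarrow> x \<bullet> v = 0 \<and> (\<forall>i\<in>?I. U i \<bullet> ?R = 0)"
    by (auto simp: newton_direction_def inner_add_right)
  moreover have "?R = - ((eqF m A x \<bullet> v) *\<^sub>R x) \<longleftrightarrow>
      jacF m A x *v v = - eqF m A x - (eqF m A x \<bullet> v) *\<^sub>R x"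
    by (metis eq_diff_eq minus_diff_commute)
  ultimately show ?thesis by blast
qed

text \<open>The projected Jacobian is completed by \<open>(x \<bullet> v) *\<^sub>R x\<close> to an
  endomorphism \<open>?T\<close> of the whole space that keeps the component along \<open>x\<close>.
  Positivity makes it injective, hence surjective, and the preimage of \<open>- eqF m A x\<close> is
  orthogonal to \<open>x\<close> because \<open>eqF m A x\<close> is.\<close>

lemma newton_direction_exists:
  fixes x :: "real^'n"
  assumes U: "orthogonal_basis_compl U x" and x: "x \<bullet> x = 1"
    and m: "m \<ge> 2" "symmetric_tensor m A"
    and pos: "\<And>v. \<lbrakk>x \<bullet> v = 0; v \<noteq> 0\<rbrakk> \<Longrightarrow> v \<bullet> (jacF m A x *v v) > 0"
  shows "\<exists>v. newton_direction m A U x v"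
proof -
  let ?J = "\<lambda>v. jacF m A x *v v"
  let ?T = "\<lambda>v. ?J v - (x \<bullet> ?J v) *\<^sub>R x + (x \<bullet> v) *\<^sub>R x"
  have xT: "x \<bullet> ?T v = x \<bullet> v" for v using x by (simp add: inner_diff_right inner_add_right)
  have lin: "linear ?T"
    by (rule linearI) (simp_all add: matrix_vector_right_distrib matrix_vector_mult_scaleR
        inner_add_right algebra_simps)
  have "v = 0" if "?T v = 0" for v
  proof (rule ccontr)
    assume "v \<noteq> 0"
    have v: "x \<bullet> v = 0" using xT[of v] that by simp
    then have "v \<bullet> ?T v = v \<bullet> ?J v" by (simp add: inner_diff_right inner_commute)
    then show False using pos[OF v \<open>v \<noteq> 0\<close>] that by simp
  qed
  then have "inj ?T" using linear_injective_0[OF lin] by blast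
  then have "surj ?T" using eucl.linear_inj_imp_surj[OF lin] by blast
  then obtain v where v: "- eqF m A x = ?T v" by (rule surjE)
  have xv: "x \<bullet> v = 0" using xT[of v] eqF_orthogonal[OF x, of m A] unfolding v[symmetric] by simp
  then have "?J v = - eqF m A x - (eqF m A x \<bullet> v) *\<^sub>R x"
    using v jacF_radial[OF m x xv] by (simp add: algebra_simps)
  then show ?thesis using newton_direction_iff[OF U x m] xv by blast
qed

text \<open>Along a Newton direction the first order term of the merit function is
  \<open>- 2 * a * merit m A x\<close>. In a full step the first order expansion of
  \<open>eqF\<close> reduces to the radial vector
  \<open>- (eqF m A x \<bullet> v) *\<^sub>R x\<close>.\<close>

lemma newton_step_estimates:
  assumes m: "m \<ge> 2" "symmetric_tensor m A"
  shows "\<exists>K>0. \<forall>U x v a. orthogonal_basis_compl U x \<longrightarrow> x \<bullet> x = 1 \<longrightarrow>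
    newton_direction m A U x v \<longrightarrow>
      merit m A (trial x v a) \<le> merit m A x - 2 * a * merit m A x + K * a\<^sup>2 * (norm v)\<^sup>2 \<and>
      norm (eqF m A (trial x v 1)) \<le> norm (eqF m A x) * norm v + K * (norm v)\<^sup>2"
proof -
  have "\<exists>C>0. \<forall>x v a. x \<bullet> x = 1 \<longrightarrow> x \<bullet> v = 0 \<longrightarrow>
    norm (eqF m A (trial x v a) - eqF m A x - a *\<^sub>R (jacF m A x *v v)) \<le> C * (norm (a *\<^sub>R v))\<^sup>2"
    by (rule polynomial_function_trial_remainder[OF polynomial_function_eqF has_derivative_eqF[OF m]])
  then obtain C where C: "C > 0" "x \<bullet> x = 1 \<Longrightarrow> x \<bullet> v = 0 \<Longrightarrow>
    norm (eqF m A (trial x v a) - eqF m A x - a *\<^sub>R (jacF m A x *v v)) \<le> C * (norm (a *\<^sub>R v))\<^sup>2"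
    for x v a by blast
  have "\<exists>C>0. \<forall>x v a. x \<bullet> x = 1 \<longrightarrow> x \<bullet> v = 0 \<longrightarrow>
    norm (merit m A (trial x v a) - merit m A x - a *\<^sub>R (eqF m A x \<bullet> (jacF m A x *v v)))
      \<le> C * (norm (a *\<^sub>R v))\<^sup>2"
    by (rule polynomial_function_trial_remainder[OF polynomial_function_merit has_derivative_merit[OF m]])
  then obtain C' where C': "C' > 0" "x \<bullet> x = 1 \<Longrightarrow> x \<bullet> v = 0 \<Longrightarrow>
    norm (merit m A (trial x v a) - merit m A x - a *\<^sub>R (eqF m A x \<bullet> (jacF m A x *v v)))
      \<le> C' * (norm (a *\<^sub>R v))\<^sup>2"
    for x v a by blast
  have "merit m A (trial x v a) \<le> merit m A x - 2 * a * merit m A x + (C + C') * a\<^sup>2 * (norm v)\<^sup>2 \<and>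
      norm (eqF m A (trial x v 1)) \<le> norm (eqF m A x) * norm v + (C + C') * (norm v)\<^sup>2"
    if U: "orthogonal_basis_compl U x" and x: "x \<bullet> x = 1" and N: "newton_direction m A U x v"
    for U x v a
  proof
    let ?F = "eqF m A x"
    have v: "x \<bullet> v = 0" and J: "jacF m A x *v v = - ?F - (?F \<bullet> v) *\<^sub>R x"
      using N newton_direction_iff[OF U x m] by blast+
    have nx: "norm x = 1" using x by (simp add: norm_eq_1)
    have "?F \<bullet> (jacF m A x *v v) = - 2 * merit m A x"
      using eqF_orthogonal[OF x, of m A]
      by (simp add: J inner_diff_right inner_commute merit_def power2_norm_eq_inner)
    then have "merit m A (trial x v a) - merit m A x + 2 * a * merit m A x \<le> C' * (norm (a *\<^sub>R v))\<^sup>2"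
      using C'(2)[OF x v, of a] by (simp add: abs_le_iff algebra_simps)
    also have "\<dots> \<le> (C + C') * (norm (a *\<^sub>R v))\<^sup>2"
      using C(1) by (intro mult_right_mono) simp_all
    finally show "merit m A (trial x v a)
        \<le> merit m A x - 2 * a * merit m A x + (C + C') * a\<^sup>2 * (norm v)\<^sup>2"
      by (simp add: power_mult_distrib algebra_simps)
    let ?G = "eqF m A (trial x v 1)"
    have "?G = - (?F \<bullet> v) *\<^sub>R x + (?G - ?F - 1 *\<^sub>R (jacF m A x *v v))"
      by (simp add: J)
    also have "norm \<dots> \<le> norm ?F * norm v + C * (norm (1 *\<^sub>R v))\<^sup>2"
    proof (rule norm_triangle_mono)
      show "norm (- (?F \<bullet> v) *\<^sub>R x) \<le> norm ?F * norm v"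
        using Cauchy_Schwarz_ineq2[of ?F v] by (simp add: nx)
      show "norm (?G - ?F - 1 *\<^sub>R (jacF m A x *v v)) \<le> C * (norm (1 *\<^sub>R v))\<^sup>2"
        by (rule C(2)[OF x v])
    qed
    also have "\<dots> \<le> norm ?F * norm v + (C + C') * (norm v)\<^sup>2"
      using C'(1) by (simp add: mult_right_mono)
    finally show "norm ?G \<le> norm ?F * norm v + (C + C') * (norm v)\<^sup>2" .
  qed
  then show ?thesis using C(1) C'(1) by (intro exI[of _ "C + C'"]) simp
qed

lemma newton_direction_slope:
  assumes "orthogonal_basis_compl U x" "x \<bullet> x = 1" "m \<ge> 2" "symmetric_tensor m A"
    and "newton_direction m A U x v"
  shows "gradient (merit m A) x \<bullet> v = - 2 * merit m A x"
proof -
  have "jacF m A x *v v = - eqF m A x - (eqF m A x \<bullet> v) *\<^sub>R x"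
    using assms newton_direction_iff by blast
  then show ?thesis
    using eqF_orthogonal[OF assms(2), of m A]
    by (simp add: gradient_merit[OF assms(3,4)] inner_diff_right inner_commute[of _ x] merit_def
        power2_norm_eq_inner)
qed

text \<open>Pairing the Newton equation with \<open>v\<close> itself bounds
  \<open>c * (norm v)\<^sup>2\<close> by \<open>norm v * norm (eqF m A x)\<close>.\<close>

lemma newton_direction_norm_le:
  assumes "orthogonal_basis_compl U x" "x \<bullet> x = 1" "m \<ge> 2" "symmetric_tensor m A"
    and N: "newton_direction m A U x v"
    and c: "c > 0" "c * (norm v)\<^sup>2 \<le> v \<bullet> (jacF m A x *v v)"
  shows "norm v \<le> norm (eqF m A x) / c"
proof (cases "v = 0")
  case False
  have v: "x \<bullet> v = 0" "jacF m A x *v v = - eqF m A x - (eqF m A x \<bullet> v) *\<^sub>R x"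
    using N newton_direction_iff[OF assms(1-4)] by blast+
  have "c * (norm v)\<^sup>2 \<le> - (v \<bullet> eqF m A x)"
    using c(2) v by (simp add: inner_diff_right inner_commute)
  also have "\<dots> \<le> norm v * norm (eqF m A x)"
    using Cauchy_Schwarz_ineq2[of v "eqF m A x"] by linarith
  finally have "c * norm v \<le> norm (eqF m A x)"
    using False by (simp add: power2_eq_square mult.left_commute)
  then show ?thesis using c(1) by (simp add: field_simps)
qed (use c in simp)

section \<open>Runs of the algorithm\<close>

text \<open>Acceptability includes that the point to be normalised is nonzero.\<close>

lemma newton_run_unit:
  assumes "newton_run m A U \<sigma> \<mu> \<rho> x d \<alpha>"
  shows "x k \<bullet> x k = 1"
proof (cases k)
  case 0
  then show ?thesis using assms by (simp add: newton_run_def)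
next
  case (Suc j)
  obtain i where "\<alpha> j = \<rho> ^ i" "acceptable m A \<sigma> (x j) (d j) (\<rho> ^ i)"
     "x (Suc j) = trial (x j) (d j) (\<alpha> j)"
    using assms by (metis newton_run_def)
  then have "x j + \<alpha> j *\<^sub>R d j \<noteq> 0" "x (Suc j) = trial (x j) (d j) (\<alpha> j)"
    by (simp_all add: acceptable_def)
  then have "norm (x k) = 1" by (simp add: Suc trial_def)
  then show ?thesis by (simp add: norm_eq_1)
qed

lemma newton_run_merit_decreasing:
  assumes "newton_run m A U \<sigma> \<mu> \<rho> x d \<alpha>" "0 < \<rho>" "0 < \<sigma>"
    and "gradient (merit m A) (x k) \<bullet> d k \<le> 0"
  shows "merit m A (x (Suc k)) \<le> merit m A (x k)"
proof -
  obtain j where "\<alpha> k = \<rho> ^ j" "acceptable m A \<sigma> (x k) (d k) (\<alpha> k)"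
     "x (Suc k) = trial (x k) (d k) (\<alpha> k)"
    using assms(1) by (metis newton_run_def)
  then have "merit m A (x (Suc k))
      \<le> merit m A (x k) + \<sigma> * \<rho> ^ j * (gradient (merit m A) (x k) \<bullet> d k)"
    by (simp add: acceptable_def)
  also have "\<dots> \<le> merit m A (x k)"
    using assms(2-4) by (simp add: mult_nonneg_nonpos)
  finally show ?thesis .
qed

text \<open>
  The length of a Newton direction and the slope of the merit function along it scale with the
  residual in such a way that the accepted step sizes are bounded below independently of the
  residual; this gives the fixed factor \<open>1 - b\<close>.
\<close>

lemma newton_run_near:
  fixes xbar :: "real^'n"
  assumes m: "m \<ge> 2" "symmetric_tensor m A"
    and U: "\<And>y. y \<bullet> y = 1 \<Longrightarrow> orthogonal_basis_compl (U y) y"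
    and par: "0 < \<sigma>" "\<sigma> < 1" "0 < \<rho>" "\<rho> < 1"
    and run: "newton_run m A U \<sigma> \<mu> \<rho> x d \<alpha>"
    and xbar: "xbar \<bullet> xbar = 1"
    and sos: "second_order_sufficient m A (U xbar) xbar"
  obtains r b c M where "r > 0" "b > 0" "c > 0" "M > 0"
    "\<And>k. dist (x k) xbar < r \<Longrightarrow>
      newton_direction m A (U (x k)) (x k) (d k) \<and>
      norm (d k) \<le> c * norm (eqF m A (x k)) \<and>
      merit m A (x (Suc k)) \<le> (1 - b) * merit m A (x k) \<and>
      norm (eqF m A (trial (x k) (d k) 1)) \<le> M * (norm (eqF m A (x k)))\<^sup>2"
proof -
  obtain c r where c: "c > 0" and r: "r > 0" and coercive:
    "\<And>y v. \<lbrakk>dist y xbar < r; y \<bullet> v = 0\<rbrakk> \<Longrightarrow> c * (norm v)\<^sup>2 \<le> v \<bullet> (jacF m A y *v v)"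
    using jacF_locally_coercive[OF second_order_sufficient_positive[OF sos U[OF xbar]]] by blast
  obtain K where K: "K > 0" and est: "\<And>U y v a. \<lbrakk>orthogonal_basis_compl U y; y \<bullet> y = 1;
      newton_direction m A U y v\<rbrakk> \<Longrightarrow>
      merit m A (trial y v a) \<le> merit m A y - 2 * a * merit m A y + K * a\<^sup>2 * (norm v)\<^sup>2 \<and>
      norm (eqF m A (trial y v 1)) \<le> norm (eqF m A y) * norm v + K * (norm v)\<^sup>2"
    using newton_step_estimates[OF m] by blast
  \<comment> \<open>With \<open>j0\<close> chosen so, the quadratic term of the expansion at
    \<open>\<rho> ^ j0\<close> is at most the fraction \<open>1 - \<sigma>\<close> of the predicted
    decrease. The choice does not depend on \<open>k\<close>.\<close>
  have "(1 - \<sigma>) * c\<^sup>2 / K > 0" using par c K by simp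
  then obtain j0 where "\<rho> ^ j0 < (1 - \<sigma>) * c\<^sup>2 / K"
    using real_arch_pow_inv par(4) by blast
  then have j0: "K * \<rho> ^ j0 \<le> (1 - \<sigma>) * c\<^sup>2" using K by (simp add: field_simps)
  \<comment> \<open>The line search stops at some exponent \<open>j \<le> j0\<close>, and the slope
    is \<open>- 2 * merit m A (x k)\<close>.\<close>
  define b where "b = 2 * \<sigma> * \<rho> ^ j0"
  define M where "M = 1 / c + K / c\<^sup>2"
  \<comment> \<open>The \<open>c\<close> of the conclusion is the reciprocal of the coercivity
    constant \<open>c\<close> used here.\<close>
  have "newton_direction m A (U (x k)) (x k) (d k) \<and>
      norm (d k) \<le> 1 / c * norm (eqF m A (x k)) \<and>
      merit m A (x (Suc k)) \<le> (1 - b) * merit m A (x k) \<and>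
      norm (eqF m A (trial (x k) (d k) 1)) \<le> M * (norm (eqF m A (x k)))\<^sup>2"
    if near: "dist (x k) xbar < r" for k
  proof -
    let ?F = "norm (eqF m A (x k))" and ?\<theta> = "merit m A (x k)"
    have xk: "x k \<bullet> x k = 1" by (rule newton_run_unit[OF run])
    note Uk = U[OF xk]
    have "v \<bullet> (jacF m A (x k) *v v) > 0" if "x k \<bullet> v = 0" "v \<noteq> 0" for v
      using coercive[OF near that(1)] c that(2) by (smt (verit) zero_less_norm_iff zero_less_power mult_pos_pos)
    then have "\<exists>v. newton_direction m A (U (x k)) (x k) v"
      by (rule newton_direction_exists[OF Uk xk m])
    then have N: "newton_direction m A (U (x k)) (x k) (d k)"
      using run by (auto simp: newton_run_def)
    then have "x k \<bullet> d k = 0" by (simp add: newton_direction_def)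
    note perp = this and dn = newton_direction_norm_le[OF Uk xk m N c coercive[OF near this]]
    have d2: "(norm (d k))\<^sup>2 \<le> ?F\<^sup>2 / c\<^sup>2"
      using power_mono[OF dn, of 2] by (simp add: power_divide)
    have th: "2 * ?\<theta> = ?F\<^sup>2" by (simp add: merit_def)
    have slope: "gradient (merit m A) (x k) \<bullet> d k = - 2 * ?\<theta>"
      by (rule newton_direction_slope[OF Uk xk m N])
    have "acceptable m A \<sigma> (x k) (d k) (\<rho> ^ j0)"
    proof -
      let ?a = "\<rho> ^ j0"
      have "K * ?a\<^sup>2 * (norm (d k))\<^sup>2 \<le> K * ?a\<^sup>2 * (?F\<^sup>2 / c\<^sup>2)"
        using d2 K by (intro mult_left_mono) simp_all
      also have "\<dots> = (K * ?a) * (?a * ?F\<^sup>2 / c\<^sup>2)" by (simp add: power2_eq_square)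
      also have "\<dots> \<le> ((1 - \<sigma>) * c\<^sup>2) * (?a * ?F\<^sup>2 / c\<^sup>2)"
        using j0 par by (intro mult_right_mono) simp_all
      also have "\<dots> = (1 - \<sigma>) * ?a * (2 * ?\<theta>)" using c th by simp
      finally have "merit m A (trial (x k) (d k) ?a) \<le> ?\<theta> - \<sigma> * ?a * (2 * ?\<theta>)"
        using est[OF Uk xk N, of ?a] by (simp add: algebra_simps)
      moreover have "x k + ?a *\<^sub>R d k \<noteq> 0"
        using trial_estimates(1)[OF xk perp, of ?a] by auto
      ultimately show ?thesis by (simp add: acceptable_def slope algebra_simps)
    qed
    moreover obtain j where j: "\<alpha> k = \<rho> ^ j" "acceptable m A \<sigma> (x k) (d k) (\<rho> ^ j)"
      "\<forall>i<j. \<not> acceptable m A \<sigma> (x k) (d k) (\<rho> ^ i)" "x (Suc k) = trial (x k) (d k) (\<alpha> k)"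
      using run by (metis newton_run_def)
    ultimately have "j \<le> j0" using not_le by blast
    then have "\<rho> ^ j0 \<le> \<rho> ^ j" using par by (simp add: power_decreasing)
    then have "b * ?\<theta> \<le> 2 * \<sigma> * \<rho> ^ j * ?\<theta>"
      unfolding b_def using par th by (intro mult_right_mono mult_left_mono) (simp_all add: merit_def)
    moreover have "merit m A (x (Suc k)) \<le> ?\<theta> - 2 * \<sigma> * \<rho> ^ j * ?\<theta>"
      using j slope by (simp add: acceptable_def algebra_simps)
    ultimately have "merit m A (x (Suc k)) \<le> (1 - b) * ?\<theta>" by (simp add: algebra_simps)
    moreover have "norm (eqF m A (trial (x k) (d k) 1)) \<le> M * ?F\<^sup>2"
    proof -
      have "?F * norm (d k) + K * (norm (d k))\<^sup>2 \<le> ?F * (?F / c) + K * (?F\<^sup>2 / c\<^sup>2)"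
        using dn d2 K by (intro add_mono mult_left_mono) simp_all
      also have "\<dots> = M * ?F\<^sup>2" by (simp add: M_def algebra_simps power2_eq_square)
      finally show ?thesis using est[OF Uk xk N] by fastforce
    qed
    ultimately show ?thesis using N dn by simp
  qed
  moreover have "b > 0" "1 / c > 0" "M > 0"
    unfolding b_def M_def using par c K by (simp_all add: add_pos_pos)
  ultimately show thesis using r that by blast
qed

text \<open>The assumption \<open>descent\<close> concerns the regularised fallback direction: the
  usual proof that its slope is nonpositive needs a symmetric Jacobian. The bound
  \<open>\<sigma> < 1/2\<close> is tied to full steps: along a Newton direction acceptance of step 1
  means \<open>merit\<close> drops to at most \<open>1 - 2 * \<sigma>\<close> times its value, which
  for \<open>\<sigma> \<ge> 1/2\<close> would force \<open>eqF\<close> to vanish at the next iterate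
  and end the run.\<close>

theorem theorem3p3:
  fixes m :: nat
    and A :: "'n::finite tensor"
    and U :: "real^'n \<Rightarrow> nat \<Rightarrow> real^'n"
    and \<sigma> \<mu> \<rho> :: real
    and x d :: "nat \<Rightarrow> real^'n"
    and \<alpha> :: "nat \<Rightarrow> real"
    and xbar :: "real^'n"
  assumes "m \<ge> 2"
    and "symmetric_tensor m A"
    and "\<And>y. y \<bullet> y = 1 \<Longrightarrow> orthogonal_basis_compl (U y) y"
    and "0 < \<sigma>" "\<sigma> < 1" "0 < \<mu>" "0 < \<rho>" "\<rho> < 1"
    and "newton_run m A U \<sigma> \<mu> \<rho> x d \<alpha>"
    and descent: "\<forall>\<^sub>F k in sequentially. gradient (merit m A) (x k) \<bullet> d k \<le> 0"
    and accumulation: "\<exists>r. strict_mono r \<and> (x \<circ> r) \<longlonglongrightarrow> xbar"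
    and "second_order_sufficient m A (U xbar) xbar"
  shows "z_eigenpair m A (tensor_form m A xbar) xbar \<and>
    (\<sigma> < 1/2 \<longrightarrow>
      (x \<longlonglongrightarrow> xbar \<longrightarrow>
        (\<lambda>k. norm (x (Suc k) - xbar)) \<in> O(\<lambda>k. (norm (x k - xbar))\<^sup>2)) \<and>
      (\<forall>\<^sub>F k in sequentially. \<alpha> k = 1))"
proof -
  note m = assms(1,2) and U = assms(3) and par = assms(4,5,7,8) and run = assms(9)
  let ?F = "\<lambda>k. norm (eqF m A (x k))" and ?\<theta> = "\<lambda>k. merit m A (x k)"
  have unit: "x k \<bullet> x k = 1" for k by (rule newton_run_unit[OF run])
  obtain s where s: "strict_mono s" and lim: "(\<lambda>n. x (s n)) \<longlonglongrightarrow> xbar"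
    using accumulation by (auto simp: o_def)
  have xbar: "xbar \<bullet> xbar = 1"
    using tendsto_inner[OF lim lim] by (simp add: unit LIMSEQ_const_iff)
  obtain r b c M where r: "r > 0" and b: "b > 0" and c: "c > 0" and M: "M > 0" and
    near: "\<And>k. dist (x k) xbar < r \<Longrightarrow>
      newton_direction m A (U (x k)) (x k) (d k) \<and> norm (d k) \<le> c * ?F k \<and>
      ?\<theta> (Suc k) \<le> (1 - b) * ?\<theta> k \<and>
      norm (eqF m A (trial (x k) (d k) 1)) \<le> M * (?F k)\<^sup>2"
    using newton_run_near[OF m U par run xbar assms(12)] by blast
  have F_lim: "(\<lambda>n. ?F (s n)) \<longlonglongrightarrow> norm (eqF m A xbar)"
    by (rule tendsto_norm[OF tendsto_polynomial_function[OF polynomial_function_eqF lim]])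

  have F_xbar: "eqF m A xbar = 0"
  proof -
    obtain N where "\<And>k. k \<ge> N \<Longrightarrow> gradient (merit m A) (x k) \<bullet> d k \<le> 0"
      using descent by (auto simp: eventually_sequentially)
    then have "decseq (\<lambda>k. ?\<theta> (k + N))"
      \<comment> \<open>The offset \<open>N\<close> is there because descent is assumed only
        eventually.\<close>
      by (intro decseq_SucI) (simp add: newton_run_merit_decreasing[OF run par(3,1)])
    moreover have "\<forall>k. 0 \<le> ?\<theta> (k + N)" by (simp add: merit_def)
    ultimately obtain l where "(\<lambda>k. ?\<theta> (k + N)) \<longlonglongrightarrow> l"
      by (rule decseq_convergent)
    then have l: "?\<theta> \<longlonglongrightarrow> l" by (rule LIMSEQ_offset)
    have l1: "(\<lambda>n. ?\<theta> (s n)) \<longlonglongrightarrow> l" and l2: "(\<lambda>n. ?\<theta> (Suc (s n))) \<longlonglongrightarrow> l"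
      using LIMSEQ_subseq_LIMSEQ[OF l s] LIMSEQ_subseq_LIMSEQ[OF LIMSEQ_Suc[OF l] s]
      by (simp_all add: o_def)
    have "\<forall>\<^sub>F n in sequentially. ?\<theta> (Suc (s n)) \<le> (1 - b) * ?\<theta> (s n)"
      using tendstoD[OF lim r] by eventually_elim (use near in blast)
    \<comment> \<open>The iterates at \<open>s n\<close> and at \<open>Suc (s n)\<close> share the
      limit \<open>l\<close> of the whole merit sequence.\<close>
    then have "l \<le> (1 - b) * l"
      by (rule tendsto_le[OF sequentially_bot tendsto_mult_left[OF l1] l2])
    then have "l \<le> 0" using b by (simp add: algebra_simps mult_le_0_iff)
    moreover have "(\<lambda>n. ?\<theta> (s n)) \<longlonglongrightarrow> merit m A xbar"
      by (rule tendsto_polynomial_function[OF polynomial_function_merit lim])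
    then have "merit m A xbar = l" using l1 LIMSEQ_unique by blast
    ultimately have "merit m A xbar \<le> 0" by simp
    then show ?thesis by (simp add: merit_def)
  qed
  then have "z_eigenpair m A (tensor_form m A xbar) xbar"
    using xbar by (simp add: z_eigenpair_def eqF_def)
  moreover have "(x \<longlonglongrightarrow> xbar \<longrightarrow>
        (\<lambda>k. norm (x (Suc k) - xbar)) \<in> O(\<lambda>k. (norm (x k - xbar))\<^sup>2)) \<and>
      (\<forall>\<^sub>F k in sequentially. \<alpha> k = 1)" if \<sigma>: "\<sigma> < 1/2"
  proof -
    \<comment> \<open>The bound \<open>1/2\<close> makes the residual halve. The Armijo test for
      step 1 needs \<open>\<eta>\<^sup>2 \<le> 1 - 2 * \<sigma>\<close>, and as
      \<open>\<eta> \<le> 1\<close> no square root has to be taken.\<close>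
    define \<eta> where "\<eta> = min (1/2) (1 - 2 * \<sigma>)"
    have \<eta>: "0 < \<eta>" "\<eta> \<le> 1/2" "\<eta>\<^sup>2 \<le> 1 - 2 * \<sigma>"
    proof -
      show "0 < \<eta>" "\<eta> \<le> 1/2" using \<sigma> unfolding \<eta>_def by linarith+
      then have "\<eta> * \<eta> \<le> \<eta> * 1" by (intro mult_left_mono) auto
      also have "\<dots> \<le> 1 - 2 * \<sigma>" by (simp add: \<eta>_def)
      finally show "\<eta>\<^sup>2 \<le> 1 - 2 * \<sigma>" by (simp add: power2_eq_square)
    qed
    \<comment> \<open>An invariant: a full step moves the iterate by at most \<open>2 * c * ?F k\<close> and halves \<open>?F k\<close>.\<close>
    define P where "P k \<longleftrightarrow> dist (x k) xbar + 4 * c * ?F k < r \<and> M * ?F k \<le> \<eta>" for k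
    have step: "\<alpha> k = 1 \<and> ?F (Suc k) \<le> M * (?F k)\<^sup>2 \<and> 2 * ?F (Suc k) \<le> ?F k \<and>
      dist (x (Suc k)) (x k) \<le> 2 * c * ?F k" if P: "P k" for k
    proof -
      let ?t = "trial (x k) (d k) 1"
      have "0 \<le> 4 * c * ?F k" using c by simp
      then have "dist (x k) xbar < r" using P unfolding P_def by linarith
      note n = near[OF this]
      then have N: "newton_direction m A (U (x k)) (x k) (d k)" and dn: "norm (d k) \<le> c * ?F k"
        by blast+
      then have perp: "x k \<bullet> d k = 0" by (simp add: newton_direction_def)
      have q: "norm (eqF m A ?t) \<le> M * (?F k)\<^sup>2" using n by blast
      also have "\<dots> = (M * ?F k) * ?F k" by (simp add: power2_eq_square)
      also have "\<dots> \<le> \<eta> * ?F k" using P by (intro mult_right_mono) (simp_all add: P_def)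
      finally have Ft: "norm (eqF m A ?t) \<le> \<eta> * ?F k" .
      have "(norm (eqF m A ?t))\<^sup>2 \<le> (\<eta> * ?F k)\<^sup>2" using Ft by (rule power_mono) simp
      also have "\<dots> \<le> (1 - 2 * \<sigma>) * (?F k)\<^sup>2"
        unfolding power_mult_distrib using \<eta>(3) by (intro mult_right_mono) simp_all
      finally have "merit m A ?t \<le> (1 - 2 * \<sigma>) * ?\<theta> k" by (simp add: merit_def)
      moreover have "x k + 1 *\<^sub>R d k \<noteq> 0"
        using trial_estimates(1)[OF unit perp, of 1] by auto
      ultimately have "acceptable m A \<sigma> (x k) (d k) (\<rho> ^ 0)"
        by (simp add: acceptable_def newton_direction_slope[OF U[OF unit] unit m N] algebra_simps)
      moreover obtain j where "\<alpha> k = \<rho> ^ j" "\<forall>i<j. \<not> acceptable m A \<sigma> (x k) (d k) (\<rho> ^ i)"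
        "x (Suc k) = trial (x k) (d k) (\<alpha> k)"
        using run by (metis newton_run_def)
      ultimately have a: "\<alpha> k = 1" and xS: "x (Suc k) = ?t"
        by (metis gr0I power_0)+
      have "\<eta> * ?F k \<le> 1/2 * ?F k" using \<eta>(2) by (intro mult_right_mono) simp_all
      then have "2 * ?F (Suc k) \<le> ?F k" using Ft by (simp add: xS)
      moreover have "dist (x (Suc k)) (x k) \<le> 2 * c * ?F k"
        using trial_estimates(3)[OF unit perp, of 1] dn by (simp add: xS dist_norm)
      ultimately show ?thesis using a q by (simp add: xS)
    qed
    \<comment> \<open>Halving the residual frees at least \<open>2 * c * ?F k\<close> in the second
      summand, which pays for the move of the iterate; hence the weight 4.\<close>
    have contract: "dist (x (Suc k)) y + 4 * c * ?F (Suc k) \<le> dist (x k) y + 4 * c * ?F k"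
      if "P k" for k y
    proof -
      have "2 * c * (2 * ?F (Suc k)) \<le> 2 * c * ?F k"
        using step[OF that] c by (intro mult_left_mono) simp_all
      then show ?thesis using step[OF that] dist_triangle[of "x (Suc k)" y "x k"] by simp
    qed
    have P_Suc: "P (Suc k)" if P: "P k" for k
    proof -
      have "M * (2 * ?F (Suc k)) \<le> M * ?F k" using step[OF P] M by (intro mult_left_mono) simp_all
      moreover have "0 \<le> M * ?F (Suc k)" using M by simp
      ultimately have "M * ?F (Suc k) \<le> M * ?F k" by simp
      then show ?thesis using P contract[OF P, of xbar] by (simp add: P_def)
    qed
    \<comment> \<open>Since \<open>eqF m A xbar = 0\<close>, both quantities tend to 0 along the
      subsequence. One index satisfying \<open>P\<close> is enough, because \<open>P_Suc\<close>
      then covers all later ones without assuming convergence.\<close>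
    have "(\<lambda>n. dist (x (s n)) xbar + 4 * c * ?F (s n)) \<longlonglongrightarrow> dist xbar xbar + 4 * c * norm (eqF m A xbar)"
      by (intro tendsto_intros lim F_lim)
    moreover have "(\<lambda>n. M * ?F (s n)) \<longlonglongrightarrow> M * norm (eqF m A xbar)"
      by (intro tendsto_intros F_lim)
    ultimately have "\<forall>\<^sub>F n in sequentially. dist (x (s n)) xbar + 4 * c * ?F (s n) < r"
      "\<forall>\<^sub>F n in sequentially. M * ?F (s n) < \<eta>"
      using r \<eta>(1) F_xbar by (auto dest: order_tendstoD(2))
    then have "\<forall>\<^sub>F n in sequentially. P (s n)"
      by eventually_elim (simp add: P_def)
    then obtain k0 where k0: "P k0" by (auto simp: eventually_sequentially)
    have P: "P k" if "k0 \<le> k" for k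
      using that k0 by (rule dec_induct) (rule P_Suc)
    have "(\<lambda>k. norm (x (Suc k) - xbar)) \<in> O(\<lambda>k. (norm (x k - xbar))\<^sup>2)" if conv: "x \<longlonglongrightarrow> xbar"
    proof -
      \<comment> \<open>The inequality \<open>contract\<close> iterated from \<open>k\<close> to
        \<open>j\<close> with the fixed point of reference \<open>y = x k\<close>; letting
        \<open>j\<close> tend to infinity gives the error bound.\<close>
      have "dist (x j) (x k) + 4 * c * ?F j \<le> 4 * c * ?F k" if "k0 \<le> k" "k \<le> j" for j k
        using that(2)
      proof (induction j rule: dec_induct)
        case (step j)
        then show ?case using contract[OF P[of j], of "x k"] that(1) by simp
      qed simp
      moreover have "0 \<le> 4 * c * ?F j" for j using c by simp
      ultimately have "dist (x j) (x k) \<le> 4 * c * ?F k" if "k0 \<le> k" "k \<le> j" for j k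
        using that by (smt (verit))
      then have error: "dist xbar (x k) \<le> 4 * c * ?F k" if "k0 \<le> k" for k
        using that by (intro LIMSEQ_le_const2[OF tendsto_dist[OF conv tendsto_const]]) blast
      have "\<exists>L>0. quadratic_remainder (sphere 0 1) (eqF m A) (\<lambda>x h. jacF m A x *v h) L"
        by (rule polynomial_function_quadratic_remainder[OF polynomial_function_eqF bounded_sphere
            has_derivative_eqF[OF m]])
      then obtain L where L: "quadratic_remainder (sphere 0 1) (eqF m A) (\<lambda>x h. jacF m A x *v h) L"
        by blast
      have "norm (x (Suc k) - xbar) \<le> 4 * c * M * L\<^sup>2 * (norm (x k - xbar))\<^sup>2" if k: "k0 \<le> k" for k
      proof -
        have "?F k \<le> L * norm (x k - xbar)"
          using quadratic_remainderD(4)[OF L, of xbar "x k"] unit xbar F_xbar by (simp add: norm_eq_1)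
        then have F2: "(?F k)\<^sup>2 \<le> L\<^sup>2 * (norm (x k - xbar))\<^sup>2"
          unfolding power_mult_distrib[symmetric] by (rule power_mono) simp
        \<comment> \<open>Error bound at \<open>Suc k\<close>, then the quadratic decrease of the
          residual, then the Lipschitz bound \<open>L\<close> for \<open>eqF\<close>, which vanishes
          at \<open>xbar\<close>.\<close>
        have "norm (x (Suc k) - xbar) \<le> 4 * c * ?F (Suc k)"
          using error[of "Suc k"] k by (simp add: dist_norm norm_minus_commute)
        also have "\<dots> \<le> 4 * c * (M * (L\<^sup>2 * (norm (x k - xbar))\<^sup>2))"
          using step[OF P[OF k]] c M F2
          by (intro mult_left_mono) (auto intro: order_trans mult_left_mono)
        finally show ?thesis by (simp add: mult.assoc)
      qed
      then show ?thesis
        by (intro bigoI[of _ "4 * c * M * L\<^sup>2"]) (auto simp: eventually_sequentially)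
    qed
    moreover have "\<forall>\<^sub>F k in sequentially. \<alpha> k = 1"
      using P step by (auto simp: eventually_sequentially)
    ultimately show ?thesis by blast
  qed
  ultimately show ?thesis by blast
qed

end
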